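(* The smallest minor-closed class of matroids that contains all Catalan matroids $M_n$ ($n\ge 0$) is the class $\mathcal{C}$ of generalized Catalan matroids.
   Context: Lattice paths start at $(0,0)$ and use steps $E=(1,0)$ and $N=(0,1)$, written as words in $\{E,N\}$. For lattice paths $P,Q$ from $(0,0)$ to $(m,r)$ with $P$ never going above $Q$, let $\mathcal{P}$ be the set of lattice paths from $(0,0)$ to $(m,r)$ going neither above $Q$ nor below $P$, and for $1\le i\le r$ let $N_i=\{j:\text{step } j \text{ is the } i\text{-th North step of some path in }\mathcal{P}\}$; $M[P,Q]$ is the transversal matroid on $[m+r]$ with presentation $(N_1,\ldots,N_r)$. The $n$-th Catalan matroid is $M_n=M[E^nN^n,(EN)^n]$. A generalized Catalan matroid is a matroid isomorphic to $M[E^mN^r,Q]$ for some $m,r$ and lattice path $Q$ from $(0,0)$ to $(m,r)$. *)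

theory Defs
  imports Main
begin

section \<open>Matroids\<close>

datatype 'a indep_system = Indep_System (ground: "'a set") (indep_sets: "'a set set")

definition matroid :: "'a indep_system \<Rightarrow> bool" where
  "matroid M \<longleftrightarrow>
     finite (ground M) \<and>
     indep_sets M \<subseteq> Pow (ground M) \<and>
     {} \<in> indep_sets M \<and>
     (\<forall>X Y. Y \<in> indep_sets M \<and> X \<subseteq> Y \<longrightarrow> X \<in> indep_sets M) \<and>
     (\<forall>X Y. X \<in> indep_sets M \<and> Y \<in> indep_sets M \<and> card X < card Y \<longrightarrow>
        (\<exists>y \<in> Y - X. insert y X \<in> indep_sets M))"

text \<open>The two ground sets may have different types. As \<open>indep_sets N\<close> is required to be exactly
  the family of images, \<open>N\<close> is a matroid as soon as \<open>M\<close> is.\<close>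

definition isomorphic :: "'a indep_system \<Rightarrow> 'b indep_system \<Rightarrow> bool" where
  "isomorphic M N \<longleftrightarrow>
     (\<exists>f. bij_betw f (ground M) (ground N) \<and> indep_sets N = (\<lambda>X. f ` X) ` indep_sets M)"

definition deletion :: "'a indep_system \<Rightarrow> 'a set \<Rightarrow> 'a indep_system" where
  "deletion M X = Indep_System (ground M - X) {I \<in> indep_sets M. I \<subseteq> ground M - X}"

definition basis_of :: "'a indep_system \<Rightarrow> 'a set \<Rightarrow> 'a set \<Rightarrow> bool" where
  "basis_of M X B \<longleftrightarrow>
     B \<in> indep_sets M \<and> B \<subseteq> X \<and> (\<forall>B' \<in> indep_sets M. B \<subseteq> B' \<and> B' \<subseteq> X \<longrightarrow> B' = B)"

definition contraction :: "'a indep_system \<Rightarrow> 'a set \<Rightarrow> 'a indep_system" where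
  "contraction M X =
     Indep_System (ground M - X)
       {I. I \<subseteq> ground M - X \<and> (\<exists>B. basis_of M X B \<and> I \<union> B \<in> indep_sets M)}"

definition is_minor :: "'a indep_system \<Rightarrow> 'a indep_system \<Rightarrow> bool" where
  "is_minor N M \<longleftrightarrow>
     (\<exists>X Y. X \<subseteq> ground M \<and> Y \<subseteq> ground M \<and> X \<inter> Y = {} \<and> N = deletion (contraction M X) Y)"

text \<open>As usual in matroid theory, a class of matroids is closed under isomorphism. The matroids
  in a class are represented here by those whose ground set consists of elements of the type \<open>'a\<close>;
  when \<open>'a\<close> is infinite, every (finite) matroid has an isomorphic copy of this kind.\<close>

definition matroid_class :: "'a indep_system set \<Rightarrow> bool" where
  "matroid_class K \<longleftrightarrow>
     (\<forall>M \<in> K. matroid M) \<and> (\<forall>M \<in> K. \<forall>N. isomorphic M N \<longrightarrow> N \<in> K)"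

definition minor_closed_class :: "'a indep_system set \<Rightarrow> bool" where
  "minor_closed_class K \<longleftrightarrow> matroid_class K \<and> (\<forall>M \<in> K. \<forall>N. is_minor N M \<longrightarrow> N \<in> K)"

definition partial_transversal :: "'i set \<Rightarrow> ('i \<Rightarrow> 'a set) \<Rightarrow> 'a set \<Rightarrow> bool" where
  "partial_transversal J A X \<longleftrightarrow> (\<exists>\<phi>. inj_on \<phi> X \<and> \<phi> ` X \<subseteq> J \<and> (\<forall>x \<in> X. x \<in> A (\<phi> x)))"

definition transversal_matroid :: "'a set \<Rightarrow> 'i set \<Rightarrow> ('i \<Rightarrow> 'a set) \<Rightarrow> 'a indep_system" where
  "transversal_matroid S J A = Indep_System S {X. X \<subseteq> S \<and> partial_transversal J A X}"

section \<open>Lattice paths\<close>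

datatype step = East | North

definition lattice_paths :: "nat \<Rightarrow> nat \<Rightarrow> step list set" where
  "lattice_paths m r = {p. count_list p East = m \<and> count_list p North = r}"

text \<open>For paths with the same endpoints. After \<open>k\<close> steps both paths are on the antidiagonal
  \<open>x + y = k\<close>, where heights are compared; the lemma \<open>never_above_iff_points\<close> below gives the
  equivalent comparison along vertical lines.\<close>

definition never_above :: "step list \<Rightarrow> step list \<Rightarrow> bool" where
  "never_above p q \<longleftrightarrow>
     (\<forall>k \<le> length p. count_list (take k p) North \<le> count_list (take k q) North)"

definition path_points :: "step list \<Rightarrow> (nat \<times> nat) set" where
  "path_points p =
     {(count_list (take k p) East, count_list (take k p) North) | k. k \<le> length p}"

lemma count_East_North: "count_list p East + count_list p North = length p"
proof (induction p)
  case (Cons s p)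
  then show ?case by (cases s) auto
qed simp

lemma count_list_take_mono: "k \<le> l \<Longrightarrow> count_list (take k p) s \<le> count_list (take l p) s"
proof -
  assume "k \<le> l"
  then have "take l p = take k p @ take (l - k) (drop k p)"
    by (metis le_add_diff_inverse take_add)
  then show ?thesis by simp
qed

lemma count_list_take_reaches:
  "c \<le> count_list p s \<Longrightarrow> \<exists>k \<le> length p. count_list (take k p) s = c"
proof (induction p arbitrary: c)
  case (Cons t p)
  show ?case
  proof (cases "c = 0")
    case True
    then show ?thesis by (intro exI[of _ 0]) simp
  next
    case False
    define d where "d = (if t = s then c - 1 else c)"
    have "d \<le> count_list p s" using Cons.prems False by (auto simp: d_def)
    then obtain k where "k \<le> length p" "count_list (take k p) s = d" using Cons.IH by blast
    then show ?thesis using False by (intro exI[of _ "Suc k"]) (auto simp: d_def split: if_splits)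
  qed
qed simp

lemma never_above_iff_points:
  assumes "p \<in> lattice_paths m r" and "q \<in> lattice_paths m r"
  shows "never_above p q \<longleftrightarrow>
    (\<forall>(x, y) \<in> path_points p. \<exists>y'. (x, y') \<in> path_points q \<and> y \<le> y')"
proof -
  have len: "length p = m + r" "length q = m + r"
    using assms count_East_North[of p] count_East_North[of q] by (auto simp: lattice_paths_def)
  have sum: "count_list (take k w) East + count_list (take k w) North = k"
    if "k \<le> length w" for k w using that count_East_North[of "take k w"] by simp
  show ?thesis
  proof
    assume L: "never_above p q"
    have "\<exists>y'. (count_list (take k p) East, y') \<in> path_points q \<and> count_list (take k p) North \<le> y'"
      if k: "k \<le> length p" for k
    proof -
      let ?x = "count_list (take k p) East"
      have "count_list p East = count_list q East"
        using assms by (simp add: lattice_paths_def)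
      with count_list_take_mono[OF k, of p East] have "?x \<le> count_list q East"
        by simp
      from count_list_take_reaches[OF this]
      obtain l0 where l0: "l0 \<le> length q" "count_list (take l0 q) East = ?x"
        by (elim exE conjE)
      have le: "count_list (take k p) North \<le> count_list (take k q) North"
        using L k by (simp add: never_above_def)
      define l where "l = max k l0"
      have "count_list (take l q) East = ?x"
      proof (cases "k \<le> l0")
        case True
        then show ?thesis using l0 by (simp add: l_def max_def)
      next
        case False
        then have "?x \<le> count_list (take k q) East"
          using count_list_take_mono[of l0 k q East] l0 by simp
        then show ?thesis using False le sum[of k p] sum[of k q] k len by (simp add: l_def max_def)
      qed
      moreover have "l \<le> length q" using l0 k len by (simp add: l_def)
      ultimately have l: "l \<le> length q" "count_list (take l q) East = ?x" by simp_all
      have "count_list (take k p) North \<le> count_list (take l q) North"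
        using le count_list_take_mono[of k l q North] by (simp add: l_def)
      moreover have "(?x, count_list (take l q) North) \<in> path_points q"
        unfolding path_points_def mem_Collect_eq using l by (intro exI[of _ l]) simp
      ultimately show ?thesis by (intro exI conjI)
    qed
    then show "\<forall>(x, y) \<in> path_points p. \<exists>y'. (x, y') \<in> path_points q \<and> y \<le> y'"
      by (auto simp: path_points_def[of p])
  next
    assume R: "\<forall>(x, y) \<in> path_points p. \<exists>y'. (x, y') \<in> path_points q \<and> y \<le> y'"
    show "never_above p q"
      unfolding never_above_def
    proof (intro allI impI)
      fix k assume k: "k \<le> length p"
      have "(count_list (take k p) East, count_list (take k p) North) \<in> path_points p"
        using k unfolding path_points_def mem_Collect_eq by (intro exI[of _ k]) simp
      with R obtain y' where y': "(count_list (take k p) East, y') \<in> path_points q"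
        "count_list (take k p) North \<le> y'"
        by auto
      then obtain l where l: "l \<le> length q" "count_list (take l q) East = count_list (take k p) East"
        "count_list (take k p) North \<le> count_list (take l q) North"
        by (auto simp: path_points_def)
      have "k \<le> l" using l sum[of k p] sum[of l q] k by linarith
      then have "count_list (take k q) East \<le> count_list (take k p) East"
        using count_list_take_mono[of k l q East] l by simp
      then show "count_list (take k p) North \<le> count_list (take k q) North"
        using sum[of k p] sum[of k q] k len by linarith
    qed
  qed
qed

section \<open>Lattice path matroids\<close>

text \<open>Steps are numbered from 1, lists from 0.\<close>

definition is_nth_north_step :: "step list \<Rightarrow> nat \<Rightarrow> nat \<Rightarrow> bool" where
  "is_nth_north_step p i j \<longleftrightarrow>
     1 \<le> j \<and> j \<le> length p \<and> p ! (j - 1) = North \<and> count_list (take j p) North = i"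

definition paths_between :: "step list \<Rightarrow> step list \<Rightarrow> step list set" where
  "paths_between P Q =
     {p \<in> lattice_paths (count_list P East) (count_list P North).
        never_above p Q \<and> never_above P p}"

definition north_steps :: "step list \<Rightarrow> step list \<Rightarrow> nat \<Rightarrow> nat set" where
  "north_steps P Q i = {j. \<exists>p \<in> paths_between P Q. is_nth_north_step p i j}"

text \<open>Meaningful when \<open>P\<close> and \<open>Q\<close> have the same endpoint \<open>(m, r)\<close>; then \<open>m + r = length P\<close>
  and \<open>r = count_list P North\<close>.\<close>

definition lattice_path_matroid :: "step list \<Rightarrow> step list \<Rightarrow> nat indep_system" where
  "lattice_path_matroid P Q =
     transversal_matroid {1..length P} {1..count_list P North} (north_steps P Q)"

definition catalan_matroid :: "nat \<Rightarrow> nat indep_system" where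
  "catalan_matroid n =
     lattice_path_matroid (replicate n East @ replicate n North) (concat (replicate n [East, North]))"

definition generalized_catalan :: "'a indep_system \<Rightarrow> bool" where
  "generalized_catalan M \<longleftrightarrow>
     (\<exists>m r Q. Q \<in> lattice_paths m r \<and>
        isomorphic (lattice_path_matroid (replicate m East @ replicate r North) Q) M)"

definition generalized_catalan_class :: "'a indep_system set" where
  "generalized_catalan_class = {M. generalized_catalan M}"

text \<open>\<open>catalan_matroid n\<close> itself lives on the type \<open>nat\<close>, so that membership of \<open>M\<^sub>n\<close> in a class
  is membership of all its copies with ground set in \<open>'a\<close>.\<close>

definition contains_catalan_matroids :: "'a indep_system set \<Rightarrow> bool" where
  "contains_catalan_matroids K \<longleftrightarrow> (\<forall>n M. isomorphic (catalan_matroid n) M \<longrightarrow> M \<in> K)"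

end

theory Submission
  imports Defs
begin

text \<open>In \<open>M[E\<^sup>mN\<^sup>r, Q]\<close> a set is independent iff, for every \<open>k\<close>, it has at most as many elements
  in \<open>{1..k}\<close> as \<open>Q\<close> has North steps among its first \<open>k\<close> steps. More generally, bounding the number
  of elements in each set of a chain by arbitrary numbers defines a matroid; this family is visibly
  closed under deletion and contraction, and each member is a generalized Catalan matroid, with
  North steps at the elements of the greedy basis along the chain. Conversely, \<open>M[E\<^sup>mN\<^sup>r, Q]\<close> is a
  minor of the Catalan matroid \<open>M\<^sub>n\<close> for \<open>n = m + r\<close>: each step of \<open>Q\<close> becomes a block \<open>EN\<close> of
  which one element is kept.\<close>

section \<open>Nested systems\<close>

text \<open>The chain consists of the sets \<open>{x \<in> S. pos x \<le> k}\<close>, so this is a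
  laminar matroid whose family is a chain, also called a nested matroid. Ties in \<open>pos\<close>
  and arbitrary values of \<open>h\<close> are allowed, so that a deletion only shrinks
  \<open>S\<close> and a contraction only lowers \<open>h\<close>.\<close>

definition nested_system :: "'a set \<Rightarrow> ('a \<Rightarrow> nat) \<Rightarrow> (nat \<Rightarrow> nat) \<Rightarrow> 'a indep_system" where
  "nested_system S pos h =
     Indep_System S {I. I \<subseteq> S \<and> (\<forall>k. card {x \<in> I. pos x \<le> k} \<le> h k)}"

lemma isomorphic_trans:
  assumes "isomorphic L M" and "isomorphic M N"
  shows "isomorphic L N"
proof -
  obtain f g where f: "bij_betw f (ground L) (ground M)" "indep_sets M = (\<lambda>X. f ` X) ` indep_sets L"
    and g: "bij_betw g (ground M) (ground N)" "indep_sets N = (\<lambda>X. g ` X) ` indep_sets M"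
    using assms by (auto simp: isomorphic_def)
  show ?thesis
    unfolding isomorphic_def
    using bij_betw_trans[OF f(1) g(1)] f(2) g(2)
    by (intro exI[of _ "g \<circ> f"]) (simp add: image_comp o_def)
qed

text \<open>Reduces the equality of two families of sets to an equivalence for single subsets of the
  ground set, where bounds on cardinalities can be compared directly.\<close>

lemma isomorphic_systemI:
  assumes "bij_betw f (ground M) (ground N)"
    and "indep_sets M \<subseteq> Pow (ground M)" "indep_sets N \<subseteq> Pow (ground N)"
    and iff: "\<And>I. I \<subseteq> ground M \<Longrightarrow> f ` I \<in> indep_sets N \<longleftrightarrow> I \<in> indep_sets M"
  shows "isomorphic M N"
proof -
  have "J \<in> (\<lambda>X. f ` X) ` indep_sets M" if J: "J \<in> indep_sets N" for J
  proof -
    obtain I where "I \<subseteq> ground M" "J = f ` I"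
      using J assms(1,3) by (metis PowD bij_betw_imp_surj_on in_mono subset_imageE)
    then show ?thesis using iff J by blast
  qed
  moreover have "f ` I \<in> indep_sets N" if "I \<in> indep_sets M" for I
    using that iff assms(2) by blast
  ultimately have "indep_sets N = (\<lambda>X. f ` X) ` indep_sets M" by blast
  then show ?thesis using assms(1) by (auto simp: isomorphic_def)
qed

text \<open>For augmentation, an element of \<open>Y - X\<close> of maximal position can be added: a bound it violates
  would force an element of \<open>Y - X\<close> beyond it.\<close>

lemma matroid_nested_system:
  assumes "finite S"
  shows "matroid (nested_system S pos h)"
proof -
  have sub: "\<forall>k. card {x \<in> X. pos x \<le> k} \<le> h k"
    if "Y \<subseteq> S" "\<forall>k. card {x \<in> Y. pos x \<le> k} \<le> h k" "X \<subseteq> Y" for X Y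
  proof
    fix k
    have "card {x \<in> X. pos x \<le> k} \<le> card {x \<in> Y. pos x \<le> k}"
      using that assms by (intro card_mono) (auto intro: finite_subset)
    then show "card {x \<in> X. pos x \<le> k} \<le> h k" using that(2) le_trans by blast
  qed
  have aug: "\<exists>y \<in> Y - X. \<forall>k. card {x \<in> insert y X. pos x \<le> k} \<le> h k"
    if X: "X \<subseteq> S" "\<forall>k. card {x \<in> X. pos x \<le> k} \<le> h k"
      and Y: "Y \<subseteq> S" "\<forall>k. card {x \<in> Y. pos x \<le> k} \<le> h k"
      and less: "card X < card Y" for X Y
  proof -
    have fin: "finite X" "finite Y" using X Y assms by (auto intro: finite_subset)
    have "Y - X \<noteq> {}" using less fin by (metis Diff_eq_empty_iff card_mono not_le)
    then obtain y where y: "y \<in> Y - X" and max: "\<And>z. z \<in> Y - X \<Longrightarrow> pos z \<le> pos y"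
      using fin Max_in[of "pos ` (Y - X)"] Max_ge[of "pos ` (Y - X)"]
      by (metis (no_types, lifting) finite_Diff finite_imageI image_iff image_is_empty)
    have "card {x \<in> insert y X. pos x \<le> k} \<le> h k" for k
    proof (cases "pos y \<le> k")
      case False
      then have "{x \<in> insert y X. pos x \<le> k} = {x \<in> X. pos x \<le> k}" by auto
      then show ?thesis using X by simp
    next
      case True
      then have ins: "{x \<in> insert y X. pos x \<le> k} = insert y {x \<in> X. pos x \<le> k}" by auto
      have sep: "card Z = card {x \<in> Z. pos x \<le> k} + card {x \<in> Z. k < pos x}"
        if "finite Z" for Z
        using that by (subst card_Un_disjoint[symmetric]) (auto intro: arg_cong[of _ _ card])
      \<comment> \<open>No element of \<open>Y - X\<close> lies beyond \<open>pos y \<le> k\<close>,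
        so the surplus of \<open>Y\<close> over \<open>X\<close> sits in positions up to
        \<open>k\<close> and leaves room there for \<open>y\<close>.\<close>
      have "{x \<in> Y. k < pos x} \<subseteq> {x \<in> X. k < pos x}"
        using max True by fastforce
      then have "card {x \<in> Y. k < pos x} \<le> card {x \<in> X. k < pos x}"
        using fin by (intro card_mono) auto
      then have "card {x \<in> X. pos x \<le> k} < card {x \<in> Y. pos x \<le> k}"
        using sep[OF fin(1)] sep[OF fin(2)] less by linarith
      also have "\<dots> \<le> h k" using Y by simp
      finally show ?thesis using fin y unfolding ins by simp
    qed
    with y show ?thesis by blast
  qed
  show ?thesis
    unfolding matroid_def nested_system_def indep_system.sel mem_Collect_eq
  proof (intro conjI allI impI; (elim conjE)?)
    show "finite S" by fact
    show "{I. I \<subseteq> S \<and> (\<forall>k. card {x \<in> I. pos x \<le> k} \<le> h k)} \<subseteq> Pow S" by blast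
  next
    fix X Y k
    assume "Y \<subseteq> S" "\<forall>k. card {x \<in> Y. pos x \<le> k} \<le> h k" "X \<subseteq> Y"
    then show "X \<subseteq> S" "card {x \<in> X. pos x \<le> k} \<le> h k" using sub by blast+
  next
    fix X Y
    assume XY: "X \<subseteq> S" "\<forall>k. card {x \<in> X. pos x \<le> k} \<le> h k"
      "Y \<subseteq> S" "\<forall>k. card {x \<in> Y. pos x \<le> k} \<le> h k" "card X < card Y"
    from aug[OF this] show "\<exists>y \<in> Y - X. insert y X \<subseteq> S \<and> (\<forall>k. card {x \<in> insert y X. pos x \<le> k} \<le> h k)"
      using XY by blast
  qed auto
qed

section \<open>Bases\<close>

lemma matroid_indepD:
  assumes "matroid M"
  shows "I \<in> indep_sets M \<Longrightarrow> finite I"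
    and "I \<in> indep_sets M \<Longrightarrow> J \<subseteq> I \<Longrightarrow> J \<in> indep_sets M"
proof -
  have "finite (ground M)" and "I \<in> indep_sets M \<Longrightarrow> I \<subseteq> ground M"
    using assms by (auto simp: matroid_def)
  then show "I \<in> indep_sets M \<Longrightarrow> finite I" using finite_subset by blast
  show "I \<in> indep_sets M \<Longrightarrow> J \<subseteq> I \<Longrightarrow> J \<in> indep_sets M"
    using assms unfolding matroid_def by blast
qed

lemma matroid_augment:
  assumes "matroid M" "I \<in> indep_sets M" "J \<in> indep_sets M" "card I < card J"
  obtains y where "y \<in> J - I" "insert y I \<in> indep_sets M"
proof -
  have "\<exists>y \<in> J - I. insert y I \<in> indep_sets M"
    using assms by (simp add: matroid_def)
  then show thesis using that by blast
qed

lemma basis_ofD: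
  assumes "basis_of M X B"
  shows "B \<in> indep_sets M" and "B \<subseteq> X"
    and "B' \<in> indep_sets M \<Longrightarrow> B \<subseteq> B' \<Longrightarrow> B' \<subseteq> X \<Longrightarrow> B' = B"
proof -
  note * = assms[unfolded basis_of_def]
  show "B \<in> indep_sets M" "B \<subseteq> X" using * by blast+
  show "B' \<in> indep_sets M \<Longrightarrow> B \<subseteq> B' \<Longrightarrow> B' \<subseteq> X \<Longrightarrow> B' = B"
    using bspec[OF conjunct2[OF conjunct2[OF *]]] by blast
qed

lemma basis_ofI:
  assumes "B \<in> indep_sets M" and "B \<subseteq> X"
    and "\<And>B'. B' \<in> indep_sets M \<Longrightarrow> B \<subseteq> B' \<Longrightarrow> B' \<subseteq> X \<Longrightarrow> B' = B"
  shows "basis_of M X B"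
  unfolding basis_of_def by (intro conjI ballI impI; (elim conjE)?; rule assms)

text \<open>Otherwise augmentation would add an element of \<open>I\<close>, hence of
  \<open>X\<close>, to the maximal set \<open>B\<close>.\<close>

lemma card_indep_le_basis:
  assumes M: "matroid M" and B: "basis_of M X B" and I: "I \<in> indep_sets M" "I \<subseteq> X"
  shows "card I \<le> card B"
proof (rule ccontr)
  assume "\<not> card I \<le> card B"
  then obtain y where y: "y \<in> I - B" "insert y B \<in> indep_sets M"
    using matroid_augment[OF M basis_ofD(1)[OF B] I(1)] by auto
  have "insert y B = B"
    using y I(2) basis_ofD(2)[OF B] by (intro basis_ofD(3)[OF B]) auto
  then show False using y(1) by blast
qed

lemma matroid_augment_to:
  assumes M: "matroid M" and I: "I \<in> indep_sets M" and J: "J \<in> indep_sets M" "card I \<le> card J"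
  shows "\<exists>K \<in> indep_sets M. I \<subseteq> K \<and> K \<subseteq> I \<union> J \<and> card K = card J"
  using I J(2)
proof (induction "card J - card I" arbitrary: I)
  case 0
  then show ?case by (intro bexI[of _ I]) auto
next
  case (Suc n)
  then have "card I < card J" by simp
  then obtain y where y: "y \<in> J - I" "insert y I \<in> indep_sets M"
    using matroid_augment[OF M Suc.prems(1) J(1)] by blast
  have "card (insert y I) = Suc (card I)"
    using y matroid_indepD(1)[OF M Suc.prems(1)] by simp
  then obtain K where "K \<in> indep_sets M" "insert y I \<subseteq> K" "K \<subseteq> insert y I \<union> J" "card K = card J"
    using Suc.hyps(1)[of "insert y I"] Suc.hyps(2) y \<open>card I < card J\<close>
    by (metis Suc_leI Suc_diff_Suc diff_Suc_Suc nat.inject)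
  then show ?case using y by (intro bexI[of _ K]) auto
qed

text \<open>A contraction is defined through some basis of \<open>X\<close>; this makes the choice
  immaterial. Extend \<open>B'\<close> within \<open>B' \<union> I \<union> B\<close> to the size of
  \<open>I \<union> B\<close>. Maximality of \<open>B'\<close> keeps new elements of
  \<open>X\<close> out, and since bases of \<open>X\<close> have equal size, all of \<open>I\<close>
  must have been added.\<close>

lemma basis_Un_indep:
  assumes M: "matroid M" and B: "basis_of M X B" and B': "basis_of M X B'"
    and I: "I \<inter> X = {}" "I \<union> B \<in> indep_sets M"
  shows "I \<union> B' \<in> indep_sets M"
proof -
  have ind: "B \<in> indep_sets M" "B' \<in> indep_sets M" "B \<subseteq> X" "B' \<subseteq> X"
    using B B' by (auto simp: basis_of_def)
  have fin: "finite I" "finite B" "finite B'"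
    using matroid_indepD(1)[OF M] I(2) ind by auto
  have "card B = card B'"
    using card_indep_le_basis[OF M B] card_indep_le_basis[OF M B'] ind by (simp add: le_antisym)
  have card: "card (I \<union> B) = card I + card B'" "card (I \<union> B') = card I + card B'"
    using \<open>card B = card B'\<close> card_Un_disjoint[of I B] card_Un_disjoint[of I B'] fin I(1) ind by auto
  then obtain K where K: "K \<in> indep_sets M" "B' \<subseteq> K" "K \<subseteq> B' \<union> (I \<union> B)" "card K = card (I \<union> B)"
    using matroid_augment_to[OF M ind(2) I(2)] by auto
  have "K \<inter> X \<in> indep_sets M" using matroid_indepD(2)[OF M K(1)] by blast
  then have "K \<inter> X = B'" using K(2) ind by (intro basis_ofD(3)[OF B']) auto
  then have "K \<subseteq> I \<union> B'" using K(3) ind(3) by blast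
  then have "K = I \<union> B'"
    using K(4) card fin by (intro card_subset_eq) auto
  then show ?thesis using K by simp
qed

text \<open>One step of the greedy algorithm. If \<open>x\<close> is accepted, removing a new
  \<open>x\<close> from a larger independent set leaves one bounded by the maximality of
  \<open>B\<close>; if it is rejected, no independent superset of \<open>B\<close> contains
  \<open>x\<close>.\<close>

lemma basis_of_insert:
  assumes M: "matroid M" and B: "basis_of M X B"
  shows "basis_of M (insert x X) (if insert x B \<in> indep_sets M then insert x B else B)"
proof (cases "insert x B \<in> indep_sets M")
  case True
  have max: "B' = insert x B" if B': "B' \<in> indep_sets M" "insert x B \<subseteq> B'" "B' \<subseteq> insert x X" for B'
  proof (cases "x \<in> X")
    case True
    then have "B' = B" using B' by (intro basis_ofD(3)[OF B]) auto
    then show ?thesis using B'(2) by blast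
  next
    case False
    have "B' - {x} \<in> indep_sets M" using matroid_indepD(2)[OF M B'(1)] by blast
    then have "B' - {x} = B" using B' False basis_ofD(2)[OF B] by (intro basis_ofD(3)[OF B]) auto
    then show ?thesis using B' by blast
  qed
  have "insert x B \<subseteq> insert x X" using basis_ofD(2)[OF B] by blast
  from basis_ofI[OF True this max] show ?thesis using True by (simp only: if_True)
next
  case False
  have max: "B' = B" if B': "B' \<in> indep_sets M" "B \<subseteq> B'" "B' \<subseteq> insert x X" for B'
  proof -
    have "x \<notin> B'"
    proof
      assume "x \<in> B'"
      then have "insert x B \<subseteq> B'" using B'(2) by blast
      then show False using False matroid_indepD(2)[OF M B'(1)] by blast
    qed
    then show ?thesis using B' by (intro basis_ofD(3)[OF B]) auto
  qed
  have "B \<subseteq> insert x X" using basis_ofD(2)[OF B] by blast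
  from basis_ofI[OF basis_ofD(1)[OF B] this max] show ?thesis using False by (simp only: if_False)
qed

text \<open>A single \<open>B\<close> serves all prefixes at once, because the greedy algorithm
  never revises a decision. Its elements later become the North steps of a path.\<close>

lemma greedy_basis:
  assumes M: "matroid M" and "distinct xs"
  shows "\<exists>B. \<forall>k. basis_of M (set (take k xs)) (B \<inter> set (take k xs))"
  using assms(2)
proof (induction xs rule: rev_induct)
  case Nil
  then show ?case using M by (auto simp: basis_of_def matroid_def)
next
  case (snoc x xs)
  then obtain B0 where B0: "\<And>k. basis_of M (set (take k xs)) (B0 \<inter> set (take k xs))" by auto
  \<comment> \<open>The induction hypothesis says nothing about \<open>B0\<close> outside
    \<open>xs\<close>; in particular \<open>B0\<close> might contain \<open>x\<close>.\<close>
  define B where "B = B0 \<inter> set xs"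
  have B: "basis_of M (set (take k xs)) (B \<inter> set (take k xs))" for k
    using B0[of k] set_take_subset[of k xs] by (simp add: B_def inf_absorb2 Int_assoc)
  define B' where "B' = (if insert x B \<in> indep_sets M then insert x B else B)"
  have "basis_of M (set xs) B" using B[of "length xs"] by (simp add: B_def Int_assoc)
  then have B': "basis_of M (insert x (set xs)) B'"
    using basis_of_insert[OF M] by (simp add: B'_def)
  have "basis_of M (set (take k (xs @ [x]))) (B' \<inter> set (take k (xs @ [x])))" for k
  proof (cases "k \<le> length xs")
    case True
    then have "B' \<inter> set (take k (xs @ [x])) = B \<inter> set (take k xs)"
      using snoc.prems set_take_subset[of k xs] by (auto simp: B'_def)
    then show ?thesis using True B[of k] by simp
  next
    case False
    have "B' \<subseteq> insert x (set xs)" using B' by (auto simp: basis_of_def)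
    then have "B' \<inter> insert x (set xs) = B'" by blast
    then show ?thesis using False B' by simp
  qed
  then show ?case by blast
qed

lemma ex_basis:
  assumes M: "matroid M" and "finite X"
  shows "\<exists>B. basis_of M X B"
proof -
  obtain xs where xs: "set xs = X" "distinct xs" using finite_distinct_list[OF assms(2)] by blast
  from greedy_basis[OF M xs(2)]
  obtain B where "basis_of M (set (take (length xs) xs)) (B \<inter> set (take (length xs) xs))" by blast
  then show ?thesis using xs(1) by auto
qed

section \<open>Minors of nested systems\<close>

lemma deletion_nested_system:
  "deletion (nested_system S pos h) Y = nested_system (S - Y) pos h"
  by (auto simp: deletion_def nested_system_def)

text \<open>By \<open>basis_Un_indep\<close> the given \<open>B\<close> alone decides independence,
  and it uses up its own share of every bound. The subtraction is never truncated, since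
  \<open>B\<close> itself satisfies the bounds.\<close>

lemma contraction_nested_system:
  assumes S: "finite S" and B: "basis_of (nested_system S pos h) X B"
  shows "contraction (nested_system S pos h) X =
    nested_system (S - X) pos (\<lambda>k. h k - card {x \<in> B. pos x \<le> k})"
proof -
  let ?M = "nested_system S pos h"
  have M: "matroid ?M" using matroid_nested_system[OF S] .
  have B_le: "card {x \<in> B. pos x \<le> k} \<le> h k" for k
    using B by (simp add: basis_of_def nested_system_def)
  have B_sub: "B \<subseteq> X" "B \<subseteq> S" using B by (auto simp: basis_of_def nested_system_def)
  have "(\<exists>B'. basis_of ?M X B' \<and> I \<union> B' \<in> indep_sets ?M) \<longleftrightarrow>
    (\<forall>k. card {x \<in> I. pos x \<le> k} \<le> h k - card {x \<in> B. pos x \<le> k})" if I: "I \<subseteq> S - X" for I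
  proof -
    have split: "card {x \<in> I \<union> B. pos x \<le> k} = card {x \<in> I. pos x \<le> k} + card {x \<in> B. pos x \<le> k}" for k
    proof -
      have "{x \<in> I \<union> B. pos x \<le> k} = {x \<in> I. pos x \<le> k} \<union> {x \<in> B. pos x \<le> k}" by auto
      moreover have "finite I" "finite B" "I \<inter> B = {}"
        using I B_sub S by (auto intro: finite_subset)
      ultimately show ?thesis by (auto intro!: card_Un_disjoint)
    qed
    have "(\<exists>B'. basis_of ?M X B' \<and> I \<union> B' \<in> indep_sets ?M) \<longleftrightarrow> I \<union> B \<in> indep_sets ?M"
      using basis_Un_indep[OF M _ B] B I by blast
    also have "\<dots> \<longleftrightarrow> (\<forall>k. card {x \<in> I \<union> B. pos x \<le> k} \<le> h k)"
      using I B_sub by (auto simp: nested_system_def)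
    also have "\<dots> \<longleftrightarrow> (\<forall>k. card {x \<in> I. pos x \<le> k} \<le> h k - card {x \<in> B. pos x \<le> k})"
      unfolding split using B_le by (simp add: le_diff_conv2)
    finally show ?thesis .
  qed
  then have "{I. I \<subseteq> S - X \<and> (\<exists>B'. basis_of ?M X B' \<and> I \<union> B' \<in> indep_sets ?M)} =
    {I. I \<subseteq> S - X \<and> (\<forall>k. card {x \<in> I. pos x \<le> k} \<le> h k - card {x \<in> B. pos x \<le> k})}"
    by blast
  moreover have "ground ?M = S" by (simp add: nested_system_def)
  ultimately show ?thesis
    unfolding contraction_def by (simp only:) (simp only: nested_system_def)
qed

lemma minor_nested_system:
  assumes "finite S" and "is_minor N (nested_system S pos h)"
  shows "\<exists>S' h'. finite S' \<and> N = nested_system S' pos h'"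
proof -
  let ?M = "nested_system S pos h"
  obtain X Y where X: "X \<subseteq> S" and N: "N = deletion (contraction ?M X) Y"
    using assms(2) by (auto simp: is_minor_def nested_system_def)
  obtain B where "basis_of ?M X B"
    using ex_basis[OF matroid_nested_system] assms(1) X finite_subset by metis
  then have "N = nested_system (S - X - Y) pos (\<lambda>k. h k - card {x \<in> B. pos x \<le> k})"
    using N by (simp add: contraction_nested_system[OF assms(1)] deletion_nested_system)
  then show ?thesis using assms(1) by blast
qed

text \<open>Positions are pulled back along the inverse bijection and the bounds stay the same, so
  isomorphic copies are again literally nested systems.\<close>

lemma isomorphic_nested_systemD:
  assumes "isomorphic (nested_system S pos h) N"
  shows "\<exists>f. bij_betw f S (ground N) \<and> N = nested_system (f ` S) (pos \<circ> inv_into S f) h"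
proof -
  obtain f where f: "bij_betw f S (ground N)"
    and N: "indep_sets N = (\<lambda>X. f ` X) ` {I. I \<subseteq> S \<and> (\<forall>k. card {x \<in> I. pos x \<le> k} \<le> h k)}"
    using assms by (auto simp: isomorphic_def nested_system_def)
  have inj: "inj_on f S" and im: "ground N = f ` S"
    using f by (auto simp: bij_betw_def)
  have card: "card {y \<in> f ` I. pos (inv_into S f y) \<le> k} = card {x \<in> I. pos x \<le> k}" if "I \<subseteq> S" for I k
  proof -
    have "{y \<in> f ` I. pos (inv_into S f y) \<le> k} = f ` {x \<in> I. pos x \<le> k}"
      using that inj by (auto simp: inv_into_f_f subset_iff)
    then show ?thesis
      using inj that by (simp add: card_image inj_on_subset[OF inj] subset_iff)
  qed
  have "indep_sets N = {J. J \<subseteq> f ` S \<and> (\<forall>k. card {x \<in> J. (pos \<circ> inv_into S f) x \<le> k} \<le> h k)}"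
    unfolding N by (auto simp: card subset_image_iff)
  then show ?thesis
    using f im by (cases N) (auto simp: nested_system_def)
qed

section \<open>Generalized Catalan matroids as nested systems\<close>

lemma count_list_take_eq_card:
  "count_list (take k w) s = card {i. i < k \<and> i < length w \<and> w ! i = s}"
proof -
  have "count_list (take k w) s = card {i. i < length (take k w) \<and> s = take k w ! i}"
    by (simp add: count_list_eq_length_filter length_filter_conv_card)
  also have "{i. i < length (take k w) \<and> s = take k w ! i} = {i. i < k \<and> i < length w \<and> w ! i = s}"
    by auto
  finally show ?thesis .
qed

text \<open>A full-size set satisfying the bounds is the set of North steps of a path in the region, which
  yields its transversal. A smaller set is first enlarged by its largest missing element: beyond
  that element every position is taken, and \<open>Q\<close> has only \<open>m\<close> East steps, so no bound is violated.\<close>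

lemma lattice_path_matroid_eq_nested_system:
  assumes Q: "Q \<in> lattice_paths m r"
  shows "lattice_path_matroid (replicate m East @ replicate r North) Q =
    nested_system {1..m + r} id (\<lambda>k. count_list (take k Q) North)"
proof -
  define P where "P = replicate m East @ replicate r North"
  have P: "count_list P East = m" "count_list P North = r" "length P = m + r"
    "count_list (take k P) North \<le> k - m" for k
    by (auto simp: P_def count_list_eq_length_filter take_replicate)
  have lenQ: "length Q = m + r"
    using Q count_East_North[of Q] by (simp add: lattice_paths_def)
  \<comment> \<open>If \<open>x \<le> k\<close> is the \<open>i\<close>-th North step of a path
    below \<open>Q\<close>, then \<open>i\<close> is at most the height of \<open>Q\<close> after
    \<open>k\<close> steps; the transversal map is injective into these indices.\<close>
  have nec: "card {x \<in> X. x \<le> k} \<le> count_list (take k Q) North"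
    if X: "partial_transversal {1..r} (north_steps P Q) X" for X k
  proof -
    from X obtain \<phi> where \<phi>: "inj_on \<phi> X" "\<phi> ` X \<subseteq> {1..r}"
      "\<And>x. x \<in> X \<Longrightarrow> x \<in> north_steps P Q (\<phi> x)"
      by (auto simp: partial_transversal_def)
    have "\<phi> x \<in> {1..count_list (take k Q) North}" if x: "x \<in> X" "x \<le> k" for x
    proof -
      obtain p where p: "never_above p Q" "is_nth_north_step p (\<phi> x) x"
        using \<phi>(3)[OF x(1)] by (auto simp: north_steps_def paths_between_def)
      then have "\<phi> x \<le> count_list (take x Q) North"
        by (auto simp: never_above_def is_nth_north_step_def)
      also have "\<dots> \<le> count_list (take k Q) North"
        using x by (intro count_list_take_mono)
      finally show ?thesis using \<phi>(2) x by auto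
    qed
    then have "card {x \<in> X. x \<le> k} \<le> card {1..count_list (take k Q) North}"
      using \<phi>(1) by (intro card_inj_on_le[of \<phi>]) (auto intro: inj_on_subset)
    then show ?thesis by simp
  qed
  have full: "partial_transversal {1..r} (north_steps P Q) X"
    if X: "X \<subseteq> {1..m + r}" "\<forall>k. card {x \<in> X. x \<le> k} \<le> count_list (take k Q) North"
      and r: "card X = r" for X
  proof -
    \<comment> \<open>The path with North steps exactly at \<open>X\<close>; list index
      \<open>i\<close> is step \<open>Suc i\<close>.\<close>
    define p where "p = map (\<lambda>i. if Suc i \<in> X then North else East) [0..<m + r]"
    have cnt: "count_list (take k p) North = card {x \<in> X. x \<le> k}" for k
    proof -
      have "{x \<in> X. x \<le> k} = Suc ` {i. i < k \<and> i < length p \<and> p ! i = North}"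
      proof (intro equalityI subsetI)
        fix x assume x: "x \<in> {x \<in> X. x \<le> k}"
        then have "x \<in> {1..m + r}" using X(1) by blast
        then have "x = Suc (x - 1)" "x - 1 < m + r" by auto
        with x show "x \<in> Suc ` {i. i < k \<and> i < length p \<and> p ! i = North}"
          by (intro image_eqI[of _ _ "x - 1"]) (simp_all add: p_def)
      qed (auto simp: p_def split: if_splits)
      then show ?thesis by (simp add: count_list_take_eq_card card_image)
    qed
    have len: "length p = m + r" by (simp add: p_def)
    have "{x \<in> X. x \<le> m + r} = X" using X(1) by auto
    then have N: "count_list p North = r" using cnt[of "m + r"] len r by simp
    then have E: "count_list p East = m" using count_East_North[of p] len by simp
    have "never_above p Q" using X(2) by (simp add: never_above_def cnt)
    \<comment> \<open>With only \<open>m\<close> East steps in total, \<open>p\<close> has at least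
      \<open>k - m\<close> North steps among its first \<open>k\<close>.\<close>
    moreover have "never_above P p"
      unfolding never_above_def
    proof (intro allI impI)
      fix k assume "k \<le> length P"
      then have "count_list (take k p) East + count_list (take k p) North = k"
        using count_East_North[of "take k p"] len P(3) by simp
      moreover have "count_list (take k p) East \<le> m"
        using count_list_take_mono[of k "max k (length p)" p East] E by simp
      ultimately show "count_list (take k P) North \<le> count_list (take k p) North"
        using P(4)[of k] by linarith
    qed
    ultimately have path: "p \<in> paths_between P Q"
      using N E P by (simp add: paths_between_def lattice_paths_def)
    \<comment> \<open>The rank of \<open>x\<close> within \<open>X\<close>, which is the index of
      \<open>x\<close> among the North steps of \<open>p\<close>.\<close>
    define \<phi> where "\<phi> x = card {y \<in> X. y \<le> x}" for x
    have fin: "finite X" using X(1) finite_subset by blast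
    have less: "\<phi> x < \<phi> y" if "x \<in> X" "y \<in> X" "x < y" for x y
    proof -
      have "y \<in> {z \<in> X. z \<le> y} - {z \<in> X. z \<le> x}" using that by simp
      moreover have "{z \<in> X. z \<le> x} \<subseteq> {z \<in> X. z \<le> y}" using that by auto
      ultimately have "{z \<in> X. z \<le> x} \<subset> {z \<in> X. z \<le> y}" by blast
      then show ?thesis unfolding \<phi>_def using fin by (intro psubset_card_mono) auto
    qed
    have "inj_on \<phi> X" by (intro linorder_inj_onI') (use less in fastforce)
    moreover have "\<phi> ` X \<subseteq> {1..r}"
    proof
      fix i assume "i \<in> \<phi> ` X"
      then obtain x where x: "x \<in> X" "i = card {y \<in> X. y \<le> x}" by (auto simp: \<phi>_def)
      then have "i \<noteq> 0" using fin by auto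
      moreover have "i \<le> r" using x fin card_mono[of X "{y \<in> X. y \<le> x}"] r by auto
      ultimately show "i \<in> {1..r}" by simp
    qed
    moreover have "is_nth_north_step p (\<phi> x) x" if "x \<in> X" for x
    proof -
      have "1 \<le> x" "x \<le> m + r" using that X(1) by auto
      moreover from this have "p ! (x - 1) = North" using that by (simp add: p_def)
      ultimately show ?thesis by (simp add: is_nth_north_step_def cnt \<phi>_def len)
    qed
    ultimately show ?thesis
      using path by (auto simp: partial_transversal_def north_steps_def intro!: exI[of _ \<phi>])
  qed
  have "partial_transversal {1..r} (north_steps P Q) X"
    if X: "X \<subseteq> {1..m + r}" "\<forall>k. card {x \<in> X. x \<le> k} \<le> count_list (take k Q) North" for X
    using X
  proof (induction "r - card X" arbitrary: X)
    case 0
    \<comment> \<open>The induction measure only gives \<open>r \<le> card X\<close>; the bound at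
      \<open>k = m + r\<close> gives the converse.\<close>
    have "X = {x \<in> X. x \<le> m + r}" using 0 by auto
    then have "card X \<le> r"
      using 0(3)[rule_format, of "m + r"] lenQ Q by (simp add: lattice_paths_def)
    then show ?case using full 0 by simp
  next
    case (Suc n)
    have fin: "finite X" using Suc.prems(1) finite_subset by blast
    let ?C = "{1..m + r} - X"
    have "?C \<noteq> {}"
    proof
      assume "?C = {}"
      then have "{1..m + r} \<subseteq> X" by blast
      from card_mono[OF fin this] show False using Suc.hyps(2) by simp
    qed
    then have y: "Max ?C \<in> ?C" by (intro Max_in) auto
    define y where "y = Max ?C"
    have yC: "y \<in> ?C" and max: "\<And>z. z \<in> ?C \<Longrightarrow> z \<le> y"
      using y by (auto simp: y_def)
    have "card {x \<in> insert y X. x \<le> k} \<le> count_list (take k Q) North" for k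
    proof (cases "y \<le> k")
      case False
      then have "{x \<in> insert y X. x \<le> k} = {x \<in> X. x \<le> k}" by auto
      then show ?thesis using Suc.prems by simp
    next
      case True
      \<comment> \<open>Capping \<open>k\<close> at the path length ensures that the prefix of
        \<open>Q\<close> has exactly \<open>l\<close> steps and that \<open>m + r - l\<close>
        positions lie beyond it.\<close>
      define l where "l = min k (m + r)"
      have yl: "y \<le> l" using True yC by (auto simp: l_def)
      have eq: "{x \<in> insert y X. x \<le> k} = {x \<in> insert y X. x \<le> l}"
        using yC Suc.prems(1) by (auto simp: l_def)
      have "insert y X = {x \<in> insert y X. x \<le> l} \<union> {l<..m + r}"
      proof (intro equalityI subsetI)
        fix z assume "z \<in> insert y X"
        then show "z \<in> {x \<in> insert y X. x \<le> l} \<union> {l<..m + r}"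
          using yC Suc.prems(1) by auto
      next
        fix z assume z: "z \<in> {x \<in> insert y X. x \<le> l} \<union> {l<..m + r}"
        show "z \<in> insert y X"
        proof (rule ccontr)
          assume "z \<notin> insert y X"
          with z have "z \<in> ?C" "l < z" by auto
          then show False using max yl by fastforce
        qed
      qed
      then have "card (insert y X) = card ({x \<in> insert y X. x \<le> l} \<union> {l<..m + r})"
        by (rule arg_cong)
      also have "\<dots> = card {x \<in> insert y X. x \<le> l} + card {l<..m + r}"
        using fin by (intro card_Un_disjoint) auto
      finally have "card (insert y X) = card {x \<in> insert y X. x \<le> l} + (m + r - l)"
        by simp
      moreover have "card (insert y X) \<le> r"
        using Suc.hyps(2) yC fin by simp
      moreover have "l \<le> m + r" by (simp add: l_def)
      ultimately have "card {x \<in> insert y X. x \<le> l} + m \<le> l" by linarith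
      moreover have "count_list (take l Q) East + count_list (take l Q) North = l"
        using count_East_North[of "take l Q"] lenQ by (simp add: l_def)
      moreover have "count_list (take l Q) East \<le> m"
        using count_list_take_mono[of l "m + r" Q East] Q lenQ
        by (simp add: l_def lattice_paths_def)
      moreover have "take l Q = take k Q" using lenQ by (simp add: l_def min_def)
      ultimately show ?thesis using eq by simp
    qed
    moreover have "insert y X \<subseteq> {1..m + r}" using yC Suc.prems(1) by auto
    moreover have "n = r - card (insert y X)" using Suc.hyps(2) yC fin by simp
    ultimately have "partial_transversal {1..r} (north_steps P Q) (insert y X)"
      using Suc.hyps(1) by blast
    then show ?case
      unfolding partial_transversal_def by (meson inj_on_subset image_mono subset_insertI subset_trans subsetD)
  qed
  then show ?thesis
    using nec P unfolding P_def[symmetric]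
    by (auto simp: lattice_path_matroid_def transversal_matroid_def nested_system_def)
qed


section \<open>Equivalence of generalized Catalan matroids and nested systems\<close>

lemma generalized_catalan_imp_nested_system:
  assumes "generalized_catalan M"
  shows "\<exists>S pos h. finite S \<and> M = nested_system S pos h"
proof -
  obtain m r Q where "Q \<in> lattice_paths m r"
    and "isomorphic (lattice_path_matroid (replicate m East @ replicate r North) Q) M"
    using assms by (auto simp: generalized_catalan_def)
  then have "isomorphic (nested_system {1..m + r} id (\<lambda>k. count_list (take k Q) North)) M"
    by (simp add: lattice_path_matroid_eq_nested_system)
  from isomorphic_nested_systemD[OF this] show ?thesis by blast
qed

text \<open>An independent set meets each prefix in at most as many elements as a basis of that
  prefix. Conversely, \<open>xs\<close> is sorted by position, so every set of the chain is a prefix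
  of \<open>xs\<close>, and there \<open>B\<close> obeys the bound.\<close>

lemma nested_system_indep_iff_greedy:
  assumes sorted: "sorted (map pos xs)"
    and B: "\<And>k. basis_of (nested_system (set xs) pos h) (set (take k xs)) (B \<inter> set (take k xs))"
    and I: "I \<subseteq> set xs"
  shows "I \<in> indep_sets (nested_system (set xs) pos h) \<longleftrightarrow>
    (\<forall>k. card (I \<inter> set (take k xs)) \<le> card (B \<inter> set (take k xs)))"
proof
  let ?M = "nested_system (set xs) pos h"
  have M: "matroid ?M" by (intro matroid_nested_system) simp
  {
    assume "I \<in> indep_sets ?M"
    then have "I \<inter> set (take k xs) \<in> indep_sets ?M" for k
      using matroid_indepD(2)[OF M] by blast
    then show "\<forall>k. card (I \<inter> set (take k xs)) \<le> card (B \<inter> set (take k xs))"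
      using card_indep_le_basis[OF M B] by simp
  }
  assume le: "\<forall>k. card (I \<inter> set (take k xs)) \<le> card (B \<inter> set (take k xs))"
  have "card {x \<in> I. pos x \<le> k} \<le> h k" for k
  proof -
    define c where "c = length (takeWhile (\<lambda>x. pos x \<le> k) xs)"
    have c: "take c xs = takeWhile (\<lambda>x. pos x \<le> k) xs"
      by (simp add: c_def takeWhile_eq_take[symmetric])
    have "set (takeWhile (\<lambda>x. pos x \<le> k) xs) = {x \<in> set xs. pos x \<le> k}"
      using sorted by (induction xs) auto
    then have "{x \<in> I. pos x \<le> k} = I \<inter> set (take c xs)"
      using I by (auto simp: c)
    also have "card \<dots> \<le> card (B \<inter> set (take c xs))"
      using le by blast
    also have "B \<inter> set (take c xs) = {x \<in> B \<inter> set (take c xs). pos x \<le> k}"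
      by (auto simp: c dest: set_takeWhileD)
    also have "card \<dots> \<le> h k"
      using basis_ofD(1)[OF B[of c]] by (simp add: nested_system_def)
    finally show ?thesis .
  qed
  then show "I \<in> indep_sets ?M" using I by (simp add: nested_system_def)
qed

text \<open>The path \<open>Q\<close> reads the elements by increasing position, going North at the
  greedy basis. Its height after \<open>k\<close> steps is the rank of the first \<open>k\<close>
  elements, so its bounds are those of \<open>nested_system_indep_iff_greedy\<close>.\<close>

lemma nested_system_imp_generalized_catalan:
  assumes "finite S"
  shows "generalized_catalan (nested_system S pos h)"
proof -
  obtain ys where ys: "set ys = S" "distinct ys" using finite_distinct_list[OF assms] by blast
  define xs where "xs = sort_key pos ys"
  have xs: "set xs = S" "distinct xs" "sorted (map pos xs)"
    using ys by (simp_all add: xs_def)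
  let ?M = "nested_system S pos h"
  obtain B where B: "\<And>k. basis_of ?M (set (take k xs)) (B \<inter> set (take k xs))"
    using greedy_basis[OF matroid_nested_system[OF assms] xs(2)] by blast
  define Q where "Q = map (\<lambda>x. if x \<in> B then North else East) xs"
  define m r where "m = count_list Q East" and "r = count_list Q North"
  have Q: "Q \<in> lattice_paths m r" by (simp add: lattice_paths_def m_def r_def)
  have len: "m + r = length xs"
    using count_East_North[of Q] by (simp add: m_def r_def Q_def)
  \<comment> \<open>Ground elements of the path matroid are numbered from 1, list entries from
    0.\<close>
  define f where "f j = xs ! (j - 1)" for j
  have bij: "bij_betw f {1..m + r} S"
  proof -
    have "bij_betw (\<lambda>j. j - 1) {1..m + r} {..<length xs}"
      unfolding len by (rule bij_betw_byWitness[of _ Suc]) auto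
    from bij_betw_trans[OF this bij_betw_nth[OF xs(2) refl xs(1)[symmetric]]]
    show ?thesis by (simp add: f_def[abs_def] o_def)
  qed
  have set_take: "set (take k xs) = f ` {j \<in> {1..m + r}. j \<le> k}" for k
  proof -
    have "set (take k xs) = (\<lambda>i. xs ! i) ` {i. i < k \<and> i < length xs}"
      by (auto simp: set_conv_nth) (metis nth_take)
    also have "{i. i < k \<and> i < length xs} = (\<lambda>j. j - 1) ` {j \<in> {1..m + r}. j \<le> k}"
    proof (intro equalityI subsetI)
      fix i assume "i \<in> {i. i < k \<and> i < length xs}"
      then show "i \<in> (\<lambda>j. j - 1) ` {j \<in> {1..m + r}. j \<le> k}"
        by (intro image_eqI[of _ _ "Suc i"]) (auto simp: len)
    qed (auto simp: len)
    finally show ?thesis by (simp add: image_image f_def)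
  qed
  have cnt: "count_list (take k Q) North = card (B \<inter> set (take k xs))" for k
  proof -
    have "count_list (take k Q) North = length (filter (\<lambda>x. x \<in> B) (take k xs))"
      by (simp add: Q_def take_map count_list_eq_length_filter filter_map o_def if_distrib cong: if_cong)
    also have "\<dots> = card (set (filter (\<lambda>x. x \<in> B) (take k xs)))"
      using xs(2) by (intro distinct_card[symmetric]) simp
    also have "set (filter (\<lambda>x. x \<in> B) (take k xs)) = B \<inter> set (take k xs)" by auto
    finally show ?thesis .
  qed
  have "isomorphic (nested_system {1..m + r} id (\<lambda>k. count_list (take k Q) North)) ?M"
  proof (intro isomorphic_systemI[of f])
    show "bij_betw f (ground (nested_system {1..m + r} id (\<lambda>k. count_list (take k Q) North))) (ground ?M)"
      using bij by (simp add: nested_system_def)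
  next
    fix I assume "I \<subseteq> ground (nested_system {1..m + r} id (\<lambda>k. count_list (take k Q) North))"
    then have I: "I \<subseteq> {1..m + r}" by (simp add: nested_system_def)
    have fI: "f ` I \<subseteq> set xs" using I bij xs(1) by (auto simp: bij_betw_def)
    have "card (f ` I \<inter> set (take k xs)) = card {x \<in> I. x \<le> k}" for k
    proof -
      have inj: "inj_on f {1..m + r}" using bij by (simp add: bij_betw_def)
      have "f ` I \<inter> set (take k xs) = f ` (I \<inter> {j \<in> {1..m + r}. j \<le> k})"
        unfolding set_take using inj I by (intro inj_on_image_Int[symmetric]) auto
      also have "card \<dots> = card (I \<inter> {j \<in> {1..m + r}. j \<le> k})"
        using I by (intro card_image inj_on_subset[OF inj]) auto
      also have "I \<inter> {j \<in> {1..m + r}. j \<le> k} = {x \<in> I. x \<le> k}" using I by auto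
      finally show ?thesis .
    qed
    then show "f ` I \<in> indep_sets ?M \<longleftrightarrow>
        I \<in> indep_sets (nested_system {1..m + r} id (\<lambda>k. count_list (take k Q) North))"
      using nested_system_indep_iff_greedy[of pos xs h B "f ` I"] xs B fI I
      by (simp add: cnt nested_system_def)
  qed (auto simp: nested_system_def)
  then have "isomorphic (lattice_path_matroid (replicate m East @ replicate r North) Q) ?M"
    by (simp add: lattice_path_matroid_eq_nested_system[OF Q])
  then show ?thesis using Q by (auto simp: generalized_catalan_def)
qed

lemma generalized_catalan_iff_nested_system:
  "generalized_catalan M \<longleftrightarrow> (\<exists>S pos h. finite S \<and> M = nested_system S pos h)"
  using generalized_catalan_imp_nested_system nested_system_imp_generalized_catalan by blast

section \<open>Closure under isomorphism and minors\<close>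

lemma minor_closed_generalized_catalan: "minor_closed_class generalized_catalan_class"
  unfolding minor_closed_class_def matroid_class_def generalized_catalan_class_def mem_Collect_eq
proof (intro conjI ballI allI impI)
  fix M :: "'a indep_system" assume M: "M \<in> {M. generalized_catalan M}"
  then obtain S pos h where S: "finite S" "M = nested_system S pos h"
    by (auto simp: generalized_catalan_iff_nested_system)
  then show "matroid M" by (simp add: matroid_nested_system)
  show "generalized_catalan N" if "isomorphic M N" for N
    using M that isomorphic_trans unfolding generalized_catalan_def by blast
  show "generalized_catalan N" if "is_minor N M" for N
    using minor_nested_system S that generalized_catalan_iff_nested_system by metis
qed

section \<open>Catalan matroids\<close>

lemma catalan_path_in_lattice_paths:
  "concat (replicate n [East, North]) \<in> lattice_paths n n"
  by (induction n) (auto simp: lattice_paths_def)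

lemma contains_catalan_generalized_catalan: "contains_catalan_matroids generalized_catalan_class"
  using catalan_path_in_lattice_paths
  by (auto simp: contains_catalan_matroids_def generalized_catalan_class_def
      generalized_catalan_def catalan_matroid_def)

text \<open>Each completed block \<open>EN\<close> contributes one North step; \<open>min\<close>
  accounts for \<open>take\<close> running past the end of the path.\<close>

lemma count_list_take_catalan_path:
  "count_list (take k (concat (replicate n [East, North]))) North = min k (2 * n) div 2"
proof (induction n arbitrary: k)
  case (Suc n)
  consider "k = 0" | "k = 1" | l where "k = Suc (Suc l)"
    by (metis One_nat_def not0_implies_Suc)
  then show ?case
    by cases (auto simp: Suc)
qed simp

lemma catalan_matroid_eq_nested_system:
  "catalan_matroid n = nested_system {1..2 * n} id (\<lambda>k. min k (2 * n) div 2)"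
  unfolding catalan_matroid_def
  by (simp add: lattice_path_matroid_eq_nested_system[OF catalan_path_in_lattice_paths]
      count_list_take_catalan_path mult_2)

text \<open>Replace every step of \<open>Q\<close> by \<open>EN\<close>. If the step was East, keep the first of the two elements
  and contract the second; if it was North, keep the second and delete the first. Contracting
  cancels the North step of the block, so along the kept elements the bound is the one of \<open>Q\<close>.\<close>

lemma nested_path_isomorphic_catalan_minor:
  fixes g :: "nat \<Rightarrow> 'a"
  assumes g: "inj g" and n: "n = length Q"
  shows "\<exists>N. is_minor N (nested_system (g ` {1..2 * n}) (inv g) (\<lambda>k. min k (2 * n) div 2)) \<and>
    isomorphic N (nested_system {1..n} id (\<lambda>k. count_list (take k Q) North))"
proof -
  let ?K = "nested_system (g ` {1..2 * n}) (inv g) (\<lambda>k. min k (2 * n) div 2)"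
  let ?L = "nested_system {1..n} id (\<lambda>k. count_list (take k Q) North)"
  \<comment> \<open>Block \<open>i\<close>, counted from 0, is
    \<open>{2 * i + 1, 2 * i + 2}\<close>, and \<open>q k\<close> is the step of \<open>Q\<close>
    whose block contains \<open>k\<close>. The sets \<open>C\<close>, \<open>D\<close> and
    \<open>P\<close> hold the contracted, deleted and kept elements.\<close>
  define q where "q k = Q ! ((k - 1) div 2)" for k
  define C where "C = {k \<in> {1..2 * n}. even k \<and> q k = East}"
  define D where "D = {k \<in> {1..2 * n}. odd k \<and> q k \<noteq> East}"
  define P where "P = {k \<in> {1..2 * n}. odd k \<longleftrightarrow> q k = East}"
  have inv_g: "inv g (g k) = k" for k using g by simp
  have card_C: "card {k \<in> C. k \<le> l} = count_list (take (l div 2) Q) East" for l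
  proof -
    have "{k \<in> C. k \<le> l} = (\<lambda>i. 2 * i + 2) ` {i. i < l div 2 \<and> i < length Q \<and> Q ! i = East}"
    proof (intro equalityI subsetI)
      fix k assume k: "k \<in> {k \<in> C. k \<le> l}"
      then obtain j where "k = 2 * j" by (auto simp: C_def)
      with k obtain i where "k = 2 * i + 2" by (cases j) (auto simp: C_def)
      with k show "k \<in> (\<lambda>i. 2 * i + 2) ` {i. i < l div 2 \<and> i < length Q \<and> Q ! i = East}"
        by (intro image_eqI[of _ _ i]) (auto simp: C_def q_def n)
    qed (auto simp: C_def q_def n)
    then show ?thesis by (simp add: count_list_take_eq_card card_image inj_on_def)
  qed
  \<comment> \<open>The Catalan bound counts the completed blocks. Splitting them by their step in
    \<open>Q\<close>, the contraction of \<open>C\<close> removes exactly the East part.\<close>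
  have bound: "min k (2 * n) div 2 = count_list (take (k div 2) Q) East + count_list (take (k div 2) Q) North" for k
    using count_East_North[of "take (k div 2) Q"] by (auto simp: n min_def)
  have card_g: "card {x \<in> g ` A. inv g x \<le> k} = card {a \<in> A. a \<le> k}" for A k
  proof -
    have "{x \<in> g ` A. inv g x \<le> k} = g ` {a \<in> A. a \<le> k}" by (auto simp: inv_g)
    then show ?thesis using g by (simp add: card_image inj_on_subset)
  qed
  have C_sub: "C \<subseteq> {1..2 * n}" and D_sub: "D \<subseteq> {1..2 * n}" and CD: "C \<inter> D = {}"
    by (auto simp: C_def D_def)
  have P_eq: "{1..2 * n} - C - D = P"
    by (auto simp: C_def D_def P_def)
  \<comment> \<open>\<open>C\<close> is independent, hence its own only basis, so
    \<open>contraction_nested_system\<close> applies with \<open>C\<close> as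
    \<open>B\<close>.\<close>
  have "basis_of ?K (g ` C) (g ` C)"
  proof (rule basis_ofI)
    show "g ` C \<in> indep_sets ?K"
      using C_sub by (auto simp: nested_system_def card_g card_C bound)
  qed blast+
  then have "deletion (contraction ?K (g ` C)) (g ` D) =
      nested_system (g ` {1..2 * n} - g ` C - g ` D) (inv g)
        (\<lambda>k. min k (2 * n) div 2 - card {x \<in> g ` C. inv g x \<le> k})"
    by (simp add: contraction_nested_system deletion_nested_system)
  also have "g ` {1..2 * n} - g ` C - g ` D = g ` P"
    unfolding P_eq[symmetric] using g by (simp add: image_set_diff)
  also have "(\<lambda>k. min k (2 * n) div 2 - card {x \<in> g ` C. inv g x \<le> k}) =
      (\<lambda>k. count_list (take (k div 2) Q) North)"
    by (simp add: card_g card_C bound)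
  finally have eq: "deletion (contraction ?K (g ` C)) (g ` D) =
    nested_system (g ` P) (inv g) (\<lambda>k. count_list (take (k div 2) Q) North)" .
  have "g ` C \<subseteq> ground ?K" "g ` D \<subseteq> ground ?K"
    using C_sub D_sub by (auto simp: nested_system_def)
  moreover have "g ` C \<inter> g ` D = {}"
    using CD by (simp add: image_Int[OF g, symmetric])
  ultimately have minor: "is_minor (nested_system (g ` P) (inv g) (\<lambda>k. count_list (take (k div 2) Q) North)) ?K"
    unfolding is_minor_def using eq[symmetric] by blast
  \<comment> \<open>The number of the block containing \<open>k\<close>, now counted from 1 to match
    the steps of \<open>Q\<close>.\<close>
  define s where "s k = (k + 1) div 2" for k :: nat
  have block: "s k \<in> {1..n}" "q k = Q ! (s k - 1)" if "k \<in> {1..2 * n}" for k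
  proof -
    have "1 \<le> k" "k \<le> 2 * n" using that by auto
    then obtain i where i: "k = Suc i" "i < 2 * n" by (cases k) auto
    then have "s k = Suc (i div 2)" "i div 2 < n" by (auto simp: s_def)
    then show "s k \<in> {1..n}" by simp
    have "(k - 1) div 2 = s k - 1" using i(1) by (simp add: s_def)
    then show "q k = Q ! (s k - 1)" by (simp add: q_def)
  qed
  \<comment> \<open>Every block keeps just one element: the parity of a kept element is determined
    by the step of its block.\<close>
  have inj_s: "inj_on s P"
  proof (rule inj_onI)
    fix k l assume kl: "k \<in> P" "l \<in> P" "s k = s l"
    then have "q k = q l" using block(2)[of k] block(2)[of l] by (simp add: P_def)
    then have "odd k \<longleftrightarrow> odd l" using kl by (simp add: P_def)
    then show "k = l" using kl(3) unfolding s_def by presburger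
  qed
  have surj_s: "s ` P = {1..n}"
  proof (intro equalityI subsetI)
    fix j assume j: "j \<in> {1..n}"
    define k where "k = (if Q ! (j - 1) = East then 2 * j - 1 else 2 * j)"
    have k: "k \<in> {1..2 * n}" "s k = j" using j by (auto simp: k_def s_def)
    moreover have "odd k \<longleftrightarrow> Q ! (j - 1) = East" using j by (auto simp: k_def)
    ultimately have "k \<in> P" using block(2)[OF k(1)] by (simp add: P_def)
    then show "j \<in> s ` P" using k(2) by blast
  qed (use block(1) in \<open>auto simp: P_def\<close>)
  \<comment> \<open>Since \<open>s a \<le> k\<close> iff \<open>a \<le> 2 * k\<close>, the bounds at
    even positions are those of \<open>Q\<close>. An odd position \<open>2 * t + 1\<close> adds
    something only if it lies in \<open>A\<close>; it is then kept from an East block, so the height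
    of \<open>Q\<close> is the same after \<open>t\<close> and \<open>Suc t\<close> steps and the
    bound at \<open>Suc t\<close> suffices.\<close>
  have key: "(\<forall>k. card {a \<in> A. a \<le> k} \<le> count_list (take (k div 2) Q) North) \<longleftrightarrow>
      (\<forall>k. card {a \<in> A. s a \<le> k} \<le> count_list (take k Q) North)" if A: "A \<subseteq> P" for A
  proof
    have s_le: "s a \<le> k \<longleftrightarrow> a \<le> 2 * k" for a k unfolding s_def by presburger
    {
      assume le: "\<forall>k. card {a \<in> A. a \<le> k} \<le> count_list (take (k div 2) Q) North"
      show "\<forall>k. card {a \<in> A. s a \<le> k} \<le> count_list (take k Q) North"
      proof
        fix k
        show "card {a \<in> A. s a \<le> k} \<le> count_list (take k Q) North"
          using le[rule_format, of "2 * k"] by (simp add: s_le)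
      qed
    }
    assume le: "\<forall>k. card {a \<in> A. s a \<le> k} \<le> count_list (take k Q) North"
    have "P \<subseteq> {1..2 * n}" by (auto simp: P_def)
    then have fin: "finite A" using A by (meson finite_atLeastAtMost finite_subset)
    show "\<forall>k. card {a \<in> A. a \<le> k} \<le> count_list (take (k div 2) Q) North"
    proof
      fix k :: nat
      define t where "t = k div 2"
      show "card {a \<in> A. a \<le> k} \<le> count_list (take (k div 2) Q) North"
      proof (cases "k \<in> A \<and> odd k")
        case True
        then obtain j where "k = 2 * j + 1" by (elim conjE oddE)
        then have k: "k = 2 * t + 1" by (simp add: t_def)
        have "k \<in> P" using True A by blast
        then have "k \<le> 2 * n" "q k = East" using True by (simp_all add: P_def)
        then have "t < n" "Q ! t = East" unfolding k q_def by simp_all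
        then have "count_list (take (Suc t) Q) North = count_list (take t Q) North"
          by (simp add: take_Suc_conv_app_nth n)
        moreover have "card {a \<in> A. a \<le> k} \<le> card {a \<in> A. s a \<le> Suc t}"
          using fin unfolding k s_le by (intro card_mono) auto
        ultimately show ?thesis using le[rule_format, of "Suc t"] by (simp add: t_def)
      next
        case False
        have "{a \<in> A. a \<le> k} = {a \<in> A. s a \<le> t}"
        proof -
          have "a \<le> k \<longleftrightarrow> a \<le> 2 * t" if "a \<in> A" for a
          proof -
            have "a \<noteq> k \<or> even k" using False that by blast
            then show ?thesis unfolding t_def by presburger
          qed
          then show ?thesis by (auto simp: s_le)
        qed
        then show ?thesis using le by (simp add: t_def)
      qed
    qed
  qed
  define \<phi> where "\<phi> = s \<circ> inv g"
  have "isomorphic (nested_system (g ` P) (inv g) (\<lambda>k. count_list (take (k div 2) Q) North)) ?L"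
  proof (intro isomorphic_systemI[of \<phi>])
    have "bij_betw (inv g) (g ` P) P"
      by (rule bij_betw_byWitness[of _ g]) (auto simp: inv_g)
    moreover have "bij_betw s P {1..n}" using inj_s surj_s by (simp add: bij_betw_def)
    ultimately show "bij_betw \<phi> (ground (nested_system (g ` P) (inv g)
        (\<lambda>k. count_list (take (k div 2) Q) North))) (ground ?L)"
      by (simp add: nested_system_def \<phi>_def bij_betw_trans)
  next
    fix I assume "I \<subseteq> ground (nested_system (g ` P) (inv g) (\<lambda>k. count_list (take (k div 2) Q) North))"
    then obtain A where A: "A \<subseteq> P" "I = g ` A"
      by (auto simp: nested_system_def elim: subset_imageE)
    have "\<phi> ` I = s ` A" by (simp add: A(2) \<phi>_def image_image inv_g)
    moreover have "card {x \<in> s ` A. x \<le> k} = card {a \<in> A. s a \<le> k}" for k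
    proof -
      have "{x \<in> s ` A. x \<le> k} = s ` {a \<in> A. s a \<le> k}" by auto
      then show ?thesis using inj_s A(1) by (simp add: card_image inj_on_subset subset_iff)
    qed
    moreover have "s ` A \<subseteq> {1..n}" using A(1) surj_s by blast
    moreover have "g ` A \<subseteq> g ` P" using A(1) by blast
    ultimately show "\<phi> ` I \<in> indep_sets ?L \<longleftrightarrow>
        I \<in> indep_sets (nested_system (g ` P) (inv g) (\<lambda>k. count_list (take (k div 2) Q) North))"
      using key[OF A(1)] by (simp add: nested_system_def card_g A(2))
  qed (auto simp: nested_system_def)
  with minor show ?thesis by blast
qed

section \<open>Minimality of the class\<close>

lemma generalized_catalan_subset:
  fixes K :: "'a indep_system set"
  assumes inf: "infinite (UNIV :: 'a set)"
    and K: "minor_closed_class K" "contains_catalan_matroids K"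
  shows "generalized_catalan_class \<subseteq> K"
proof
  fix M :: "'a indep_system" assume "M \<in> generalized_catalan_class"
  then obtain m r Q where Q: "Q \<in> lattice_paths m r"
    and iso: "isomorphic (lattice_path_matroid (replicate m East @ replicate r North) Q) M"
    by (auto simp: generalized_catalan_class_def generalized_catalan_def)
  define n where "n = length Q"
  have n: "m + r = n" using Q count_East_North[of Q] by (simp add: n_def lattice_paths_def)
  \<comment> \<open>Infinitude of the type provides a copy \<open>?K\<close> of the Catalan matroid
    with ground set in \<open>'a\<close>. The class contains \<open>?K\<close>, hence its minor
    \<open>N\<close>, hence \<open>M\<close>, which is isomorphic to \<open>N\<close>.\<close>
  obtain g :: "nat \<Rightarrow> 'a" where g: "inj g"
    using infinite_countable_subset[OF inf] by blast
  let ?K = "nested_system (g ` {1..2 * n}) (inv g) (\<lambda>k. min k (2 * n) div 2)"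
  obtain N where N: "is_minor N ?K"
    "isomorphic N (nested_system {1..n} id (\<lambda>k. count_list (take k Q) North))"
    using nested_path_isomorphic_catalan_minor[OF g n_def] by blast
  have "isomorphic (catalan_matroid n) ?K"
    unfolding catalan_matroid_eq_nested_system
  proof (intro isomorphic_systemI[of g])
    fix I assume "I \<subseteq> ground (nested_system {1..2 * n} id (\<lambda>k. min k (2 * n) div 2))"
    moreover have "card {x \<in> g ` I. inv g x \<le> k} = card {a \<in> I. a \<le> k}" for k
    proof -
      have "{x \<in> g ` I. inv g x \<le> k} = g ` {a \<in> I. a \<le> k}" using g by auto
      then show ?thesis using g by (simp add: card_image inj_on_subset)
    qed
    ultimately show "g ` I \<in> indep_sets ?K \<longleftrightarrow>
        I \<in> indep_sets (nested_system {1..2 * n} id (\<lambda>k. min k (2 * n) div 2))"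
      using g by (auto simp: nested_system_def inj_image_subset_iff)
  qed (use g in \<open>auto simp: nested_system_def bij_betw_def intro: inj_on_subset\<close>)
  then have "?K \<in> K" using K(2) by (simp add: contains_catalan_matroids_def)
  then have "N \<in> K" using K(1) N(1) unfolding minor_closed_class_def by blast
  moreover have "isomorphic N M"
    using isomorphic_trans[OF N(2)] iso by (simp add: lattice_path_matroid_eq_nested_system[OF Q] n)
  ultimately show "M \<in> K"
    using K(1) unfolding minor_closed_class_def matroid_class_def by blast
qed

theorem theorem4p2:
  assumes "infinite (UNIV :: 'a set)"
  shows "minor_closed_class (generalized_catalan_class :: 'a indep_system set) \<and>
    contains_catalan_matroids (generalized_catalan_class :: 'a indep_system set) \<and>
    (\<forall>K :: 'a indep_system set.
       minor_closed_class K \<and> contains_catalan_matroids K \<longrightarrow> generalized_catalan_class \<subseteq> K)"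
  using minor_closed_generalized_catalan contains_catalan_generalized_catalan
    generalized_catalan_subset[OF assms] by blast

end
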